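(* Let $(X,d,W)$ be a convex metric space having property (C), and let $A,B\subseteq X$ be nonempty, bounded, closed and convex subsets. Suppose that $T:A\cup B\to A\cup B$ is a cyclic contraction. Then $T$ has a best proximity point, that is, there exists $u\in A\cup B$ such that $d(u,Tu)=\mathrm{dist}(A,B)$.
   Context: For nonempty subsets $A,B$ of a metric space $(X,d)$, $\mathrm{dist}(A,B)=\inf\{d(u,v):u\in A,\ v\in B\}$. A convex structure on a metric space $(X,d)$ is a mapping $W:X\times X\times[0,1]\to X$ such that for all $u,v,z\in X$ and $\lambda\in[0,1]$, $d(z,W(u,v;\lambda))\le \lambda d(z,u)+(1-\lambda)d(z,v)$. A metric space with a convex structure $W$ is called a convex metric space, denoted $(X,d,W)$. A subset $K\subseteq X$ is convex if $W(u,v;\lambda)\in K$ for all $u,v\in K$ and $\lambda\in[0,1]$. A convex metric space $(X,d,W)$ has property (C) if every bounded decreasing net of nonempty closed convex subsets of $X$ has nonempty intersection. A mapping $T:A\cup B\to A\cup B$ is cyclic if $T(A)\subseteq B$ and $T(B)\subseteq A$. It is a cyclic contraction if it is cyclic and there is some $k\in(0,1)$ with $d(Tu,Tv)\le k\,d(u,v)+(1-k)\,\mathrm{dist}(A,B)$ for all $u\in A$, $v\in B$. *)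

theory Defs
  imports "HOL-Analysis.Analysis"
begin

text \<open>
  The metric space \<open>X\<close> is the universe of a type of class \<^class>\<open>metric_space\<close>.  A convex structure
  is curried, and only its values at parameters in \<open>[0,1]\<close> are relevant.
\<close>

definition convex_structure :: "('a::metric_space \<Rightarrow> 'a \<Rightarrow> real \<Rightarrow> 'a) \<Rightarrow> bool" where
  "convex_structure W \<longleftrightarrow>
    (\<forall>u v z. \<forall>t\<in>{0..1}. dist z (W u v t) \<le> t * dist z u + (1 - t) * dist z v)"

text \<open>Convexity relative to \<open>W\<close>, as opposed to the library's \<^const>\<open>convex\<close> for real vector spaces.\<close>

definition convex_wrt :: "('a \<Rightarrow> 'a \<Rightarrow> real \<Rightarrow> 'a) \<Rightarrow> 'a set \<Rightarrow> bool" where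
  "convex_wrt W K \<longleftrightarrow> (\<forall>u\<in>K. \<forall>v\<in>K. \<forall>t\<in>{0..1}. W u v t \<in> K)"

definition directed_index :: "'i set \<Rightarrow> 'i rel \<Rightarrow> bool" where
  "directed_index I r \<longleftrightarrow>
    I \<noteq> {} \<and> preorder_on I r \<and> (\<forall>i\<in>I. \<forall>j\<in>I. \<exists>k\<in>I. (i, k) \<in> r \<and> (j, k) \<in> r)"

definition decreasing_net :: "'i set \<Rightarrow> 'i rel \<Rightarrow> ('i \<Rightarrow> 'a set) \<Rightarrow> bool" where
  "decreasing_net I r C \<longleftrightarrow>
    directed_index I r \<and> (\<forall>i\<in>I. \<forall>j\<in>I. (i, j) \<in> r \<longrightarrow> C j \<subseteq> C i)"

text \<open>
  HOL does not allow quantification over index types inside a definition.  The index set is therefore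
  drawn from the type of subsets of \<open>X\<close>; the lemma \<open>property_C_net\<close> below shows that the property then
  holds for nets over every index type, because a decreasing net of sets can be reindexed by its range.
\<close>

definition property_C :: "('a::metric_space \<Rightarrow> 'a \<Rightarrow> real \<Rightarrow> 'a) \<Rightarrow> bool" where
  "property_C W \<longleftrightarrow>
    (\<forall>(I :: 'a set set) r C.
      decreasing_net I r C \<and>
      (\<forall>i\<in>I. C i \<noteq> {} \<and> bounded (C i) \<and> closed (C i) \<and> convex_wrt W (C i))
      \<longrightarrow> (\<Inter>i\<in>I. C i) \<noteq> {})"

lemma property_C_net:
  fixes W :: "'a::metric_space \<Rightarrow> 'a \<Rightarrow> real \<Rightarrow> 'a" and I :: "'i set"
  assumes W: "property_C W" and net: "decreasing_net I r C"
    and C: "\<And>i. i \<in> I \<Longrightarrow> C i \<noteq> {} \<and> bounded (C i) \<and> closed (C i) \<and> convex_wrt W (C i)"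
  shows "(\<Inter>i\<in>I. C i) \<noteq> {}"
proof -
  define s where "s = {(X, Y). X \<in> C ` I \<and> Y \<in> C ` I \<and> Y \<subseteq> X}"
  have "preorder_on (C ` I) s"
    by (auto simp: preorder_on_def refl_on_def trans_def s_def)
  moreover have "\<exists>Z\<in>C ` I. (X, Z) \<in> s \<and> (Y, Z) \<in> s" if XY: "X \<in> C ` I" "Y \<in> C ` I" for X Y
  proof -
    obtain i j where ij: "i \<in> I" "j \<in> I" "X = C i" "Y = C j"
      using XY by auto
    then obtain k where k: "k \<in> I" "(i, k) \<in> r" "(j, k) \<in> r"
      using net unfolding decreasing_net_def directed_index_def by blast
    then have "C k \<subseteq> C i" "C k \<subseteq> C j"
      using net ij unfolding decreasing_net_def by blast+
    then show ?thesis
      using ij k by (auto simp: s_def)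
  qed
  moreover have "C ` I \<noteq> {}"
    using net by (auto simp: decreasing_net_def directed_index_def)
  ultimately have "decreasing_net (C ` I) s (\<lambda>X. X)"
    unfolding decreasing_net_def directed_index_def by (auto simp: s_def)
  moreover have "\<forall>X\<in>C ` I. X \<noteq> {} \<and> bounded X \<and> closed X \<and> convex_wrt W X"
    using C by blast
  ultimately have "(\<Inter>X\<in>C ` I. X) \<noteq> {}"
    using W unfolding property_C_def by (elim allE[of _ "C ` I"] allE[of _ s] allE[of _ "\<lambda>X. X"]) blast
  then show ?thesis
    by simp
qed

text \<open>
  For nonempty sets, \<^const>\<open>setdist\<close> is the infimum of the distances between their points.  The maps
  are total on the type, but only their values on \<open>A \<union> B\<close> are constrained.
\<close>

definition cyclic_map :: "'a set \<Rightarrow> 'a set \<Rightarrow> ('a \<Rightarrow> 'a) \<Rightarrow> bool" where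
  "cyclic_map A B T \<longleftrightarrow> T \<in> A \<union> B \<rightarrow> A \<union> B \<and> T ` A \<subseteq> B \<and> T ` B \<subseteq> A"

definition cyclic_contraction :: "'a::metric_space set \<Rightarrow> 'a set \<Rightarrow> ('a \<Rightarrow> 'a) \<Rightarrow> bool" where
  "cyclic_contraction A B T \<longleftrightarrow>
    cyclic_map A B T \<and>
    (\<exists>k\<in>{0<..<1}. \<forall>u\<in>A. \<forall>v\<in>B. dist (T u) (T v) \<le> k * dist u v + (1 - k) * setdist A B)"

definition best_proximity_point ::
    "'a::metric_space set \<Rightarrow> 'a set \<Rightarrow> ('a \<Rightarrow> 'a) \<Rightarrow> 'a \<Rightarrow> bool" where
  "best_proximity_point A B T u \<longleftrightarrow> u \<in> A \<union> B \<and> dist u (T u) = setdist A B"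

end

theory Submission
  imports Defs
begin

text \<open>
  Put \<open>A\<^sub>0 = A\<close>, \<open>B\<^sub>0 = B\<close> and let \<open>A\<^sub>n\<^sub>+\<^sub>1\<close>, \<open>B\<^sub>n\<^sub>+\<^sub>1\<close> be the closed convex hulls of \<open>T B\<^sub>n\<close>, \<open>T A\<^sub>n\<close>.  Both
  sequences decrease, and \<open>T\<close> maps \<open>A\<^sub>n\<close> into \<open>B\<^sub>n\<close>.  Closed balls are closed and convex, so taking
  hulls does not increase the largest distance between a point of one set and a point of the other;
  by the contraction inequality, the excess of this distance over \<open>dist(A,B)\<close> on \<open>A\<^sub>n \<times> B\<^sub>n\<close> is
  therefore at most \<open>k\<^sup>n\<close> times that on \<open>A \<times> B\<close>.  Property (C) gives a point \<open>u\<close> in all the \<open>A\<^sub>n\<close>, and since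
  \<open>Tu\<close> lies in all the \<open>B\<^sub>n\<close>, \<open>d(u,Tu) = dist(A,B)\<close>.
\<close>

text \<open>No continuity of \<open>W\<close> is assumed, so convexity is not known to pass to
  closures; hence the intersection of all closed convex supersets is taken.\<close>

definition closed_convex_hull ::
    "('a::metric_space \<Rightarrow> 'a \<Rightarrow> real \<Rightarrow> 'a) \<Rightarrow> 'a set \<Rightarrow> 'a set" where
  "closed_convex_hull W S = (\<lambda>K. closed K \<and> convex_wrt W K) hull S"

lemma closed_convex_closed_convex_hull:
  "closed (closed_convex_hull W S) \<and> convex_wrt W (closed_convex_hull W S)"
  unfolding closed_convex_hull_def
  by (rule hull_in) (auto simp: convex_wrt_def)

lemma closed_convex_hull_superset: "S \<subseteq> closed_convex_hull W S"
  unfolding closed_convex_hull_def by (rule hull_subset)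

lemma closed_convex_hull_minimal:
  assumes "S \<subseteq> K" "closed K" "convex_wrt W K"
  shows "closed_convex_hull W S \<subseteq> K"
  unfolding closed_convex_hull_def using assms by (simp add: hull_minimal)

lemma closed_convex_hull_mono:
  "S \<subseteq> R \<Longrightarrow> closed_convex_hull W S \<subseteq> closed_convex_hull W R"
  unfolding closed_convex_hull_def by (rule hull_mono)

lemma convex_wrt_cball:
  assumes "convex_structure W"
  shows "convex_wrt W (cball x r)"
  unfolding convex_wrt_def
proof (intro ballI)
  fix u v t assume u: "u \<in> cball x r" and v: "v \<in> cball x r" and t: "t \<in> {0..1::real}"
  have "dist x (W u v t) \<le> t * dist x u + (1 - t) * dist x v"
    using assms t unfolding convex_structure_def by blast
  also have "\<dots> \<le> t * r + (1 - t) * r"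
    using u v t by (intro add_mono mult_left_mono) auto
  finally show "W u v t \<in> cball x r"
    by (simp add: algebra_simps)
qed

text \<open>The hulls are taken one at a time: balls around points of \<open>R\<close> absorb the
  hull of \<open>S\<close>, then the ball around a point of that hull absorbs the hull of
  \<open>R\<close>.\<close>

lemma dist_closed_convex_hull_le:
  assumes W: "convex_structure W"
    and le: "\<And>x y. x \<in> S \<Longrightarrow> y \<in> R \<Longrightarrow> dist x y \<le> r"
    and x: "x \<in> closed_convex_hull W S" and y: "y \<in> closed_convex_hull W R"
  shows "dist x y \<le> r"
proof -
  have "closed_convex_hull W S \<subseteq> cball y' r" if "y' \<in> R" for y'
    using that le W by (intro closed_convex_hull_minimal convex_wrt_cball) (auto simp: dist_commute)
  then have "R \<subseteq> cball x r"
    using x by (fastforce simp: dist_commute)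
  then have "closed_convex_hull W R \<subseteq> cball x r"
    using W by (intro closed_convex_hull_minimal convex_wrt_cball) auto
  then show ?thesis
    using y by auto
qed

text \<open>The set \<open>A\<^sub>n\<close> is \<open>hull_iterate W T n A B\<close>; exchanging \<open>A\<close> and \<open>B\<close> gives \<open>B\<^sub>n\<close>.\<close>

primrec hull_iterate ::
    "('a::metric_space \<Rightarrow> 'a \<Rightarrow> real \<Rightarrow> 'a) \<Rightarrow> ('a \<Rightarrow> 'a) \<Rightarrow> nat \<Rightarrow> 'a set \<Rightarrow> 'a set \<Rightarrow> 'a set" where
  "hull_iterate W T 0 A B = A"
| "hull_iterate W T (Suc n) A B = closed_convex_hull W (T ` hull_iterate W T n B A)"

lemma hull_iterate_nonempty:
  assumes "A \<noteq> {}" "B \<noteq> {}"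
  shows "hull_iterate W T n A B \<noteq> {}"
  using assms
proof (induction n arbitrary: A B)
  case (Suc n)
  then show ?case
    using closed_convex_hull_superset[of "T ` hull_iterate W T n B A" W]
    by (metis hull_iterate.simps(2) image_is_empty subset_empty)
qed simp

lemma closed_convex_hull_iterate:
  assumes "closed A" "convex_wrt W A"
  shows "closed (hull_iterate W T n A B) \<and> convex_wrt W (hull_iterate W T n A B)"
  using assms by (cases n) (auto simp: closed_convex_closed_convex_hull)

text \<open>Cyclicity gives the first inclusion; \<open>T\<close> and the hull are monotone and the
  hypotheses symmetric in \<open>A\<close> and \<open>B\<close>, so it propagates.\<close>

lemma hull_iterate_Suc_subset:
  assumes "closed A" "convex_wrt W A" "closed B" "convex_wrt W B" "T ` A \<subseteq> B" "T ` B \<subseteq> A"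
  shows "hull_iterate W T (Suc n) A B \<subseteq> hull_iterate W T n A B"
  using assms
proof (induction n arbitrary: A B)
  case 0
  then show ?case
    by (simp add: closed_convex_hull_minimal)
next
  case (Suc n)
  have "hull_iterate W T (Suc n) B A \<subseteq> hull_iterate W T n B A"
    by (rule Suc.IH) (fact Suc.prems)+
  then have "closed_convex_hull W (T ` hull_iterate W T (Suc n) B A)
      \<subseteq> closed_convex_hull W (T ` hull_iterate W T n B A)"
    by (intro closed_convex_hull_mono image_mono)
  then show ?case
    by (simp only: hull_iterate.simps)
qed

lemma dist_hull_iterate_le:
  assumes W: "convex_structure W"
    and cyc: "T ` A \<subseteq> B" "T ` B \<subseteq> A"
    and cv: "closed A" "convex_wrt W A" "closed B" "convex_wrt W B"
    and k: "0 \<le> k"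
    and contr: "\<And>u v. u \<in> A \<Longrightarrow> v \<in> B \<Longrightarrow> dist (T u) (T v) \<le> k * dist u v + (1 - k) * d"
    and M: "\<And>u v. u \<in> A \<Longrightarrow> v \<in> B \<Longrightarrow> dist u v \<le> d + M"
    and "x \<in> hull_iterate W T n A B" "y \<in> hull_iterate W T n B A"
  shows "dist x y \<le> d + k ^ n * M"
  using assms(11,12)
proof (induction n arbitrary: x y)
  case 0
  then show ?case
    using M by simp
next
  case (Suc n)
  \<comment> \<open>The contraction inequality is available only on \<open>A\<close> and
    \<open>B\<close>.\<close>
  have sub: "hull_iterate W T n A B \<subseteq> A" "hull_iterate W T n B A \<subseteq> B"
    using lift_Suc_antimono_le[of "\<lambda>n. hull_iterate W T n A B" 0 n]
      lift_Suc_antimono_le[of "\<lambda>n. hull_iterate W T n B A" 0 n]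
      hull_iterate_Suc_subset[of A W B T] hull_iterate_Suc_subset[of B W A T] cyc cv
    by auto
  have *: "dist (T v) (T u) \<le> d + k ^ Suc n * M"
    if u: "u \<in> hull_iterate W T n A B" and v: "v \<in> hull_iterate W T n B A" for u v
  proof -
    have "dist (T v) (T u) \<le> k * dist u v + (1 - k) * d"
      using contr[of u v] u v sub by (auto simp: dist_commute)
    also have "\<dots> \<le> k * (d + k ^ n * M) + (1 - k) * d"
      using Suc.IH[OF u v] k by (simp add: mult_left_mono)
    finally show ?thesis
      by (simp add: algebra_simps)
  qed
  show ?case
    by (rule dist_closed_convex_hull_le[OF W _ Suc.prems[unfolded hull_iterate.simps]])
      (use * in auto)
qed

theorem theorem2p5:
  fixes W :: "'a::metric_space \<Rightarrow> 'a \<Rightarrow> real \<Rightarrow> 'a"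
    and A B :: "'a set" and T :: "'a \<Rightarrow> 'a"
  assumes "convex_structure W" and "property_C W"
    and "A \<noteq> {}" and "bounded A" and "closed A" and "convex_wrt W A"
    and "B \<noteq> {}" and "bounded B" and "closed B" and "convex_wrt W B"
    and "cyclic_contraction A B T"
  shows "\<exists>u. best_proximity_point A B T u"
proof -
  let ?A = "\<lambda>n. hull_iterate W T n A B" and ?B = "\<lambda>n. hull_iterate W T n B A"
  obtain k where cyc: "T ` A \<subseteq> B" "T ` B \<subseteq> A" and k: "0 < k" "k < 1"
    and contr: "\<And>u v. u \<in> A \<Longrightarrow> v \<in> B \<Longrightarrow>
      dist (T u) (T v) \<le> k * dist u v + (1 - k) * setdist A B"
    using assms(11) unfolding cyclic_contraction_def cyclic_map_def by auto
  have suc: "?A (Suc n) \<subseteq> ?A n" "?B (Suc n) \<subseteq> ?B n" for n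
    by (intro hull_iterate_Suc_subset assms cyc)+
  have anti: "?A n \<subseteq> ?A m" if "m \<le> n" for m n
    using lift_Suc_antimono_le[of ?A, OF suc(1) that] .
  have net: "decreasing_net UNIV {(m, n). m \<le> n} ?A"
    unfolding decreasing_net_def directed_index_def
  proof (intro conjI ballI impI)
    show "preorder_on UNIV {(m, n::nat). m \<le> n}"
      by (auto simp: preorder_on_def refl_on_def trans_def)
    show "\<exists>l\<in>UNIV. (m, l) \<in> {(m, n). m \<le> n} \<and> (n, l) \<in> {(m, n). m \<le> n}" for m n :: nat
      by (rule bexI[of _ "max m n"]) simp_all
    show "?A n \<subseteq> ?A m" if "(m, n) \<in> {(m, n). m \<le> n}" for m n
      using that by (intro anti) simp
  qed simp
  have "(\<Inter>n\<in>UNIV. ?A n) \<noteq> {}"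
  proof (rule property_C_net[OF assms(2) net])
    show "?A n \<noteq> {} \<and> bounded (?A n) \<and> closed (?A n) \<and> convex_wrt W (?A n)" for n
      using hull_iterate_nonempty[OF assms(3,7)] closed_convex_hull_iterate[OF assms(5,6)]
        bounded_subset[OF assms(4)] anti[of 0 n]
      by auto
  qed
  then obtain u where u: "u \<in> ?A n" for n
    by auto
  \<comment> \<open>\<open>T\<close> sends \<open>?A n\<close> into \<open>?B (Suc n)\<close>, one
    index further than needed.\<close>
  have Tu: "T u \<in> ?B n" for n
    using u[of n] suc(2)[of n] closed_convex_hull_superset[of "T ` ?A n" W] by auto
  have uA: "u \<in> A" and TuB: "T u \<in> B"
    using u[of 0] Tu[of 0] by auto
  \<comment> \<open>A common bound on distances; the initial excess is then at most
    \<open>c - setdist A B\<close>.\<close>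
  obtain c where c: "\<And>x y. x \<in> A \<union> B \<Longrightarrow> y \<in> A \<union> B \<Longrightarrow> dist x y \<le> c"
    using assms(4,8) bounded_two_points[of "A \<union> B"] by auto
  have bound: "dist u (T u) \<le> setdist A B + k ^ n * (c - setdist A B)" for n
    using c k by (intro dist_hull_iterate_le[OF assms(1) cyc assms(5,6,9,10) _ contr _ u Tu]) auto
  \<comment> \<open>As \<open>k < 1\<close>, the excess vanishes in the limit.\<close>
  have "(\<lambda>n. setdist A B + k ^ n * (c - setdist A B)) \<longlonglongrightarrow> setdist A B + 0 * (c - setdist A B)"
    using k by (intro tendsto_intros LIMSEQ_power_zero) auto
  then have "dist u (T u) \<le> setdist A B"
    using bound by (intro LIMSEQ_le_const[where X = "\<lambda>n. setdist A B + k ^ n * (c - setdist A B)"]) auto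
  moreover have "setdist A B \<le> dist u (T u)"
    using uA TuB by (rule setdist_le_dist)
  ultimately show ?thesis
    using uA unfolding best_proximity_point_def by auto
qed

end
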